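(* Let $A\in\mathbb{R}^{n\times n}$ be symmetric positive definite with largest eigenvalue $\lambda_1$, smallest eigenvalue $\lambda_n$, and condition number $\kappa=\lambda_1/\lambda_n$; let $b\in\mathbb{R}^n$, $f(x)=\tfrac12x^TAx-x^Tb$, $x^*=A^{-1}b$ and $f^*=f(x^* )=\min_x f(x)$. Fix $\ell\in\{0,\tfrac12,1,\tfrac32,2,\tfrac52,3,\dots\}$ and $\omega\in(0,2)$, and let $$c(\omega):=1-\omega(2-\omega)\frac{4\lambda_1\lambda_n}{(\lambda_1+\lambda_n)^2}.$$ Given an initial point $x_0\in\mathbb{R}^n$, let $(x_k)_{k\ge0}$ be the iterates of the Relaxed $\ell$-Minimal Gradient Descent method with relaxation parameter $\omega$. Then, for all $k\ge0$: 1. (Rate I) $\displaystyle f(x_k)-f^*\le\left(1-\omega(2-\omega)\frac1\kappa\right)^k\,(f(x_0)-f^* )$; 2. (Rate II) $\displaystyle f(x_k)-f^*\le\kappa^{2\ell}\,(c(\omega))^k\,(f(x_0)-f^* )$.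
   Context: Half-integer powers of $A$ are defined through its unique positive definite square root $A^{1/2}$, and $A^0=I$. Relaxed $\ell$-Minimal Gradient Descent method (with relaxation parameter $\omega$): from $x_0\in\mathbb{R}^n$, for $k\ge 0$ set $g_k=\nabla f(x_k)=Ax_k-b$, $y_k=A^{\ell}g_k$, $\alpha_k=\dfrac{y_k^Ty_k}{y_k^TAy_k}$, and $x_{k+1}=x_k-\omega\alpha_k g_k$. If $g_k=0$ (so $x_k=x^*$), the step is taken to be zero, i.e. $\alpha_k:=0$ and $x_{k+1}=x_k$. *)

theory Defs
  imports "HOL-Analysis.Analysis"
begin

section \<open>Symmetric positive definite matrices and their eigenvalues\<close>

definition sym_pos_def :: "real ^ 'n ^ 'n \<Rightarrow> bool" where
  "sym_pos_def A \<longleftrightarrow> transpose A = A \<and> (\<forall>x. x \<noteq> 0 \<longrightarrow> x \<bullet> (A *v x) > 0)"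

definition eigenvalues :: "real ^ 'n ^ 'n \<Rightarrow> real set" where
  "eigenvalues A = {c. \<exists>v. v \<noteq> 0 \<and> A *v v = c *\<^sub>R v}"

text \<open>\<open>Max\<close> and \<open>Min\<close> are only meaningful on finite nonempty sets; for symmetric matrices this is
  established by \<open>finite_eigenvalues\<close> and \<open>eigenvalues_nonempty\<close> below.\<close>

definition max_eigenvalue :: "real ^ 'n ^ 'n \<Rightarrow> real" where
  "max_eigenvalue A = Max (eigenvalues A)"

definition min_eigenvalue :: "real ^ 'n ^ 'n \<Rightarrow> real" where
  "min_eigenvalue A = Min (eigenvalues A)"

lemma symmetric_inner_commute:
  fixes A :: "real ^ 'n ^ 'n"
  assumes "transpose A = A"
  shows "x \<bullet> (A *v y) = (A *v x) \<bullet> y"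
  by (metis assms dot_lmul_matrix vector_transpose_matrix)

lemma finite_eigenvalues:
  fixes A :: "real ^ 'n ^ 'n"
  assumes sym: "transpose A = A"
  shows "finite (eigenvalues A)"
proof -
  have "\<forall>c. \<exists>v. c \<in> eigenvalues A \<longrightarrow> v \<noteq> 0 \<and> A *v v = c *\<^sub>R v"
    by (auto simp: eigenvalues_def)
  then obtain v where v: "v c \<noteq> 0" "A *v v c = c *\<^sub>R v c" if "c \<in> eigenvalues A" for c
    by metis
  have orth: "v c \<bullet> v d = 0" if cd: "c \<in> eigenvalues A" "d \<in> eigenvalues A" "c \<noteq> d" for c d
    using symmetric_inner_commute[OF sym, of "v c" "v d"] v[of c] v[of d] cd by auto
  have inj: "inj_on v (eigenvalues A)"
    using orth v by (metis inj_onI inner_eq_zero_iff)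
  have "pairwise orthogonal (v ` eigenvalues A)"
    using orth by (auto simp: pairwise_def orthogonal_def)
  moreover have "0 \<notin> v ` eigenvalues A" using v by force
  ultimately have "finite (v ` eigenvalues A)"
    using pairwise_orthogonal_independent independent_imp_finite by blast
  with inj show ?thesis by (simp add: finite_image_iff)
qed

lemma eigenvalues_nonempty:
  fixes A :: "real ^ 'n ^ 'n"
  assumes sym: "transpose A = A"
  shows "eigenvalues A \<noteq> {}"
proof -
  let ?q = "\<lambda>x. x \<bullet> (A *v x)"
  have "continuous_on (sphere 0 1) ?q"
    by (intro continuous_intros linear_continuous_on_compose[where g = "(*v) A"]) auto
  moreover have "sphere (0 :: real ^ 'n) 1 \<noteq> {}" by simp
  ultimately obtain v where v: "norm v = 1" and vmax: "\<And>x. norm x = 1 \<Longrightarrow> ?q x \<le> ?q v"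
    using continuous_attains_sup[of "sphere (0 :: real ^ 'n) 1" ?q] by auto
  define m where "m = ?q v"
  define B where "B = (\<lambda>x. m *\<^sub>R x - A *v x)"
  have B_add: "B (x + y) = B x + B y" and B_scale: "B (t *\<^sub>R x) = t *\<^sub>R B x" for x y t
    by (simp_all add: B_def algebra_simps matrix_vector_mult_scaleR)
  have B_sym: "x \<bullet> B y = y \<bullet> B x" for x y
    using symmetric_inner_commute[OF sym, of x y]
    by (simp add: B_def inner_diff_right inner_commute)
  have B_psd: "x \<bullet> B x \<ge> 0" for x
  proof (cases "x = 0")
    case False
    have "?q (inverse (norm x) *\<^sub>R x) \<le> m"
      unfolding m_def using False by (intro vmax) simp
    then have "(inverse (norm x))\<^sup>2 * ?q x \<le> m"
      by (simp add: matrix_vector_mult_scaleR power2_eq_square)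
    then have "?q x \<le> m * (norm x)\<^sup>2"
      using False by (simp add: field_simps)
    then show ?thesis by (simp add: B_def inner_diff_right power2_norm_eq_inner)
  qed simp
  have Bv: "v \<bullet> B v = 0"
    using v by (simp add: B_def inner_diff_right m_def flip: power2_norm_eq_inner)
  define w where "w = B v"
  define p where "p = w \<bullet> w"
  define q where "q = w \<bullet> B w"
  have "q \<ge> 0" using B_psd by (simp add: q_def)
  have "p \<ge> 0" by (simp add: p_def)
  define s where "s = p / (q + 1)"
  have "(v + (- s) *\<^sub>R w) \<bullet> B (v + (- s) *\<^sub>R w) = s * (s * q) - 2 * (s * p)"
    unfolding B_add B_scale p_def q_def
    using Bv B_sym[of v w] by (simp add: inner_add_left inner_add_right inner_diff_left inner_diff_right algebra_simps w_def)
  then have *: "s * (s * q) - 2 * (s * p) \<ge> 0" using B_psd by metis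
  have "p = 0"
  proof (rule ccontr)
    assume "p \<noteq> 0"
    with \<open>p \<ge> 0\<close> have "p > 0" by simp
    with \<open>q \<ge> 0\<close> have "s > 0" by (simp add: s_def)
    have "s * (s * q - 2 * p) \<ge> 0" using * by (simp add: algebra_simps)
    with \<open>s > 0\<close> have "2 * p \<le> s * q" by (simp add: zero_le_mult_iff)
    moreover have "s * (q + 1) = p" using \<open>q \<ge> 0\<close> by (simp add: s_def)
    ultimately show False using \<open>s > 0\<close> \<open>p > 0\<close> by (simp add: algebra_simps)
  qed
  then have "A *v v = m *\<^sub>R v" by (simp add: p_def w_def B_def)
  moreover have "v \<noteq> 0" using v by auto
  ultimately show ?thesis by (auto simp: eigenvalues_def)
qed

definition condition_number :: "real ^ 'n ^ 'n \<Rightarrow> real" where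
  "condition_number A = max_eigenvalue A / min_eigenvalue A"

section \<open>Half-integer matrix powers\<close>

text \<open>The overloaded \<open>^\<close> on \<open>real ^ 'n ^ 'n\<close> is the componentwise power, not the matrix power.\<close>

primrec matrix_power :: "real ^ 'n ^ 'n \<Rightarrow> nat \<Rightarrow> real ^ 'n ^ 'n" where
  "matrix_power A 0 = mat 1"
| "matrix_power A (Suc k) = A ** matrix_power A k"

definition matrix_sqrt :: "real ^ 'n ^ 'n \<Rightarrow> real ^ 'n ^ 'n" where
  "matrix_sqrt A = (THE B. sym_pos_def B \<and> B ** B = A)"

text \<open>Only meant for \<open>l = m / 2\<close> with \<open>m\<close> a natural number, so that the floor is exact.\<close>

definition half_integer_power :: "real ^ 'n ^ 'n \<Rightarrow> real \<Rightarrow> real ^ 'n ^ 'n" where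
  "half_integer_power A l =
    (let m = nat \<lfloor>2 * l\<rfloor>
     in if even m then matrix_power A (m div 2)
        else matrix_power A (m div 2) ** matrix_sqrt A)"

lemma half_integer_power_nat: "half_integer_power A (real k) = matrix_power A k"
proof -
  have "nat \<lfloor>2 * real k\<rfloor> = 2 * k" by linarith
  then show ?thesis by (simp add: half_integer_power_def)
qed

lemma half_integer_power_nat_plus_half:
  "half_integer_power A (real k + 1 / 2) = matrix_power A k ** matrix_sqrt A"
proof -
  have "2 * (real k + 1 / 2) = real (2 * k + 1)" by simp
  then have "nat \<lfloor>2 * (real k + 1 / 2)\<rfloor> = 2 * k + 1" by (metis floor_of_nat nat_int)
  then show ?thesis by (simp add: half_integer_power_def)
qed

section \<open>The quadratic objective\<close>

definition quad_obj :: "real ^ 'n ^ 'n \<Rightarrow> real ^ 'n \<Rightarrow> real ^ 'n \<Rightarrow> real" where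
  "quad_obj A b x = (1/2) * (x \<bullet> (A *v x)) - x \<bullet> b"

definition quad_grad :: "real ^ 'n ^ 'n \<Rightarrow> real ^ 'n \<Rightarrow> real ^ 'n \<Rightarrow> real ^ 'n" where
  "quad_grad A b x = A *v x - b"

definition quad_minimizer :: "real ^ 'n ^ 'n \<Rightarrow> real ^ 'n \<Rightarrow> real ^ 'n" where
  "quad_minimizer A b = matrix_inv A *v b"

lemma quad_obj_has_gradient:
  fixes A :: "real ^ 'n ^ 'n"
  assumes sym: "transpose A = A"
  shows "(quad_obj A b has_derivative (\<lambda>h. quad_grad A b x \<bullet> h)) (at x)"
proof -
  have lin: "((*v) A has_derivative (*v) A) (at x)"
    by (simp add: bounded_linear_imp_has_derivative linear_linear)
  have "((\<lambda>x. (1/2) * (x \<bullet> (A *v x)) - x \<bullet> b) has_derivative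
          (\<lambda>h. (1/2) * (x \<bullet> (A *v h) + h \<bullet> (A *v x)) - h \<bullet> b)) (at x)"
    by (rule derivative_eq_intros lin refl | simp)+
  moreover have "(1/2) * (x \<bullet> (A *v h) + h \<bullet> (A *v x)) - h \<bullet> b = quad_grad A b x \<bullet> h" for h
    using symmetric_inner_commute[OF sym, of x h]
    by (simp add: quad_grad_def inner_diff_left inner_diff_right inner_commute)
  ultimately show ?thesis by (simp add: quad_obj_def[abs_def])
qed

lemma quad_minimizer_solves:
  fixes A :: "real ^ 'n ^ 'n"
  assumes "sym_pos_def A"
  shows "A *v quad_minimizer A b = b"
proof -
  have "x = 0" if "A *v x = 0" for x
    using assms that by (metis sym_pos_def_def inner_zero_right less_irrefl)
  then have "invertible A"
    by (metis invertible_left_inverse matrix_left_invertible_ker)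
  then have "A ** matrix_inv A = mat 1"
    unfolding invertible_def matrix_inv_def by (rule someI2_ex) simp
  then show ?thesis
    by (simp add: quad_minimizer_def matrix_vector_mul_assoc)
qed

lemma quad_minimizer_minimizes:
  fixes A :: "real ^ 'n ^ 'n"
  assumes "sym_pos_def A"
  shows "quad_obj A b (quad_minimizer A b) \<le> quad_obj A b x"
proof -
  define z where "z = quad_minimizer A b"
  have Az: "A *v z = b" using quad_minimizer_solves[OF assms] by (simp add: z_def)
  have sym: "transpose A = A" using assms by (simp add: sym_pos_def_def)
  have "0 \<le> (x - z) \<bullet> (A *v (x - z))"
    using assms by (cases "x = z") (auto simp: sym_pos_def_def less_imp_le)
  also have "\<dots> = 2 * (quad_obj A b x - quad_obj A b z)"
    using symmetric_inner_commute[OF sym, of z x]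
    by (simp add: quad_obj_def matrix_vector_mult_diff_distrib inner_diff_left inner_diff_right
        Az inner_commute)
  finally show ?thesis by (simp add: z_def)
qed

section \<open>The relaxed \<open>l\<close>-minimal gradient descent method\<close>

definition mgd_stepsize :: "real ^ 'n ^ 'n \<Rightarrow> real ^ 'n \<Rightarrow> real \<Rightarrow> real ^ 'n \<Rightarrow> real" where
  "mgd_stepsize A b l x =
    (let g = quad_grad A b x; y = half_integer_power A l *v g
     in if g = 0 then 0 else (y \<bullet> y) / (y \<bullet> (A *v y)))"

primrec relaxed_mgd ::
  "real ^ 'n ^ 'n \<Rightarrow> real ^ 'n \<Rightarrow> real \<Rightarrow> real \<Rightarrow> real ^ 'n \<Rightarrow> nat \<Rightarrow> real ^ 'n" where
  "relaxed_mgd A b l \<omega> x0 0 = x0"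
| "relaxed_mgd A b l \<omega> x0 (Suc k) =
    (let x = relaxed_mgd A b l \<omega> x0 k
     in x - (\<omega> * mgd_stepsize A b l x) *\<^sub>R quad_grad A b x)"

definition rate_factor :: "real ^ 'n ^ 'n \<Rightarrow> real \<Rightarrow> real" where
  "rate_factor A \<omega> =
    1 - \<omega> * (2 - \<omega>) * (4 * max_eigenvalue A * min_eigenvalue A
                          / (max_eigenvalue A + min_eigenvalue A)\<^sup>2)"

end

theory Submission
  imports Defs
begin

text \<open>
  Expand the error \<open>e = x - x\<^sup>*\<close> in an orthonormal eigenbasis of \<open>A\<close> and let \<open>M j\<close> be its moments
  \<open>\<Sum> \<lambda>\<^sup>j e\<^sub>\<lambda>\<^sup>2\<close>. With \<open>m = 2 l\<close>, the objective gap is \<open>M 1 / 2\<close>, the step size is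
  \<open>M (m + 2) / M (m + 3)\<close>, and a step of size \<open>t\<close> replaces \<open>M j\<close> by
  \<open>M j - 2 t M (j + 1) + t\<^sup>2 M (j + 2)\<close>. Rate I is the case \<open>j = 1\<close>: by log-convexity of the moments
  the step is at most the exact line search step \<open>M 2 / M 3\<close>. For Rate II, the step is an
  exact line search for the potential \<open>M (m + 1)\<close>, which therefore contracts by the Kantorovich
  inequality; comparing \<open>M (m + 1)\<close> with \<open>M 1\<close> at both ends costs the factor \<open>\<kappa>\<^sup>m\<close>.
\<close>

section \<open>Orthonormal eigenbases\<close>

text \<open>A maximizer of the Rayleigh quotient over the unit sphere of \<open>S\<close> is an
  eigenvector: if its residual \<open>w\<close> were nonzero, a small move along \<open>w\<close>,
  which stays in \<open>S\<close> by invariance, would violate maximality.\<close>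

lemma symmetric_invariant_subspace_eigenvector:
  fixes A :: "real ^ 'n ^ 'n"
  assumes sym: "transpose A = A" and S: "subspace S" "S \<noteq> {0}"
    and inv: "\<And>x. x \<in> S \<Longrightarrow> A *v x \<in> S"
  obtains v c where "v \<in> S" "norm v = 1" "A *v v = c *\<^sub>R v"
proof -
  let ?q = "\<lambda>x. x \<bullet> (A *v x)"
  have "compact (sphere 0 1 \<inter> S)"
    using S closed_subspace by (intro compact_Int_closed) auto
  moreover have "continuous_on (sphere 0 1 \<inter> S) ?q"
    by (intro continuous_intros linear_continuous_on_compose[where g = "(*v) A"]) auto
  moreover have "sphere 0 1 \<inter> S \<noteq> {}"
  proof -
    obtain x where x: "x \<in> S" "x \<noteq> 0" using S subspace_0 by blast
    then have "inverse (norm x) *\<^sub>R x \<in> sphere 0 1 \<inter> S"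
      using S by (simp add: subspace_scale)
    then show ?thesis by blast
  qed
  ultimately obtain v where "v \<in> sphere 0 1 \<inter> S"
    and "\<forall>x \<in> sphere 0 1 \<inter> S. ?q x \<le> ?q v"
    using continuous_attains_sup[of "sphere 0 1 \<inter> S" ?q] by blast
  then have v: "norm v = 1" "v \<in> S"
    and vmax: "norm x = 1 \<Longrightarrow> x \<in> S \<Longrightarrow> ?q x \<le> ?q v" for x
    by auto
  define m where "m = ?q v"
  have q_le: "?q x \<le> m * (x \<bullet> x)" if "x \<in> S" for x
  proof (cases "x = 0")
    case False
    have "?q (inverse (norm x) *\<^sub>R x) \<le> m"
      unfolding m_def using False that S by (intro vmax) (auto simp: subspace_scale)
    then have "(inverse (norm x))\<^sup>2 * ?q x \<le> m"
      by (simp add: matrix_vector_mult_scaleR power2_eq_square)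
    then show ?thesis
      using False by (simp add: field_simps flip: power2_norm_eq_inner)
  qed simp
  define w where "w = m *\<^sub>R v - A *v v"
  define p where "p = w \<bullet> w"
  define q where "q = m * p - ?q w"
  have w: "w \<in> S" unfolding w_def using S v inv by (simp add: subspace_diff subspace_scale)
  have "q \<ge> 0" using q_le[OF w] by (simp add: q_def p_def)
  have vv: "v \<bullet> v = 1" using v by (simp flip: power2_norm_eq_inner)
  have wAv: "w \<bullet> (A *v v) = m * (w \<bullet> v) - p"
    by (simp add: p_def w_def inner_diff_right)
  have vAw: "v \<bullet> (A *v w) = w \<bullet> (A *v v)"
    using symmetric_inner_commute[OF sym, of v w] by (simp add: inner_commute)
  \<comment> \<open>At \<open>v - s *\<^sub>R w\<close> the nonnegative form
    \<open>m * (x \<bullet> x) - x \<bullet> (A *v x)\<close> equals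
    \<open>s\<^sup>2 * q - 2 * s * p\<close>. This choice of \<open>s\<close> makes it negative
    unless \<open>p = 0\<close>; the summand 1 keeps the quotient meaningful when
    \<open>q = 0\<close>.\<close>
  define s where "s = p / (q + 1)"
  have "?q (v - s *\<^sub>R w) \<le> m * ((v - s *\<^sub>R w) \<bullet> (v - s *\<^sub>R w))"
    using S v w by (intro q_le) (simp add: subspace_diff subspace_scale)
  then have "m - 2 * s * (w \<bullet> (A *v v)) + s\<^sup>2 * ?q w \<le> m * (1 - 2 * s * (w \<bullet> v) + s\<^sup>2 * p)"
    using vv vAw by (simp add: matrix_vector_mult_diff_distrib matrix_vector_mult_scaleR
        inner_diff_left inner_diff_right p_def inner_commute[of v w] m_def power2_eq_square algebra_simps)
  then have *: "2 * s * p \<le> s\<^sup>2 * q"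
    unfolding wAv by (simp add: q_def algebra_simps)
  have "p = 0"
  proof (rule ccontr)
    assume "p \<noteq> 0"
    moreover have "p \<ge> 0" by (simp add: p_def)
    ultimately have "p > 0" by simp
    with \<open>q \<ge> 0\<close> have "s > 0" by (simp add: s_def)
    with * have "2 * p \<le> s * q" by (simp add: power2_eq_square)
    moreover have "s * (q + 1) = p" using \<open>q \<ge> 0\<close> by (simp add: s_def)
    ultimately show False using \<open>s > 0\<close> \<open>p > 0\<close> by (simp add: algebra_simps)
  qed
  then have "A *v v = m *\<^sub>R v" by (simp add: p_def w_def)
  then show ?thesis using that v by blast
qed

text \<open>Indexing the eigenvalues by basis vectors allows multiplicities. Keeping
  \<open>B\<close> as a parameter lets \<open>A\<close> and its square root share one basis.\<close>

locale orthonormal_eigenbasis =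
  fixes A :: "real ^ 'n ^ 'n" and B :: "(real ^ 'n) set" and ev :: "real ^ 'n \<Rightarrow> real"
  assumes orth: "pairwise orthogonal B"
    and unit: "v \<in> B \<Longrightarrow> norm v = 1"
    and span: "span B = UNIV"
    and eigen: "v \<in> B \<Longrightarrow> A *v v = ev v *\<^sub>R v"

text \<open>Cardinalities of orthonormal sets of eigenvectors are bounded by the dimension, so a
  largest such set exists. If it did not span, its orthogonal complement would be nonzero and
  invariant under \<open>A\<close>, and would supply one more eigenvector.\<close>

theorem symmetric_orthonormal_eigenbasis:
  fixes A :: "real ^ 'n ^ 'n"
  assumes sym: "transpose A = A"
  obtains B ev where "orthonormal_eigenbasis A B ev"
proof -
  define P where "P = (\<lambda>B. pairwise orthogonal B \<and> (\<forall>v\<in>B. norm v = 1 \<and> (\<exists>c. A *v v = c *\<^sub>R v)))"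
  have bound: "finite B \<and> card B \<le> CARD('n)" if "P B" for B
  proof -
    have "0 \<notin> B" using that by (force simp: P_def)
    then have "independent B"
      using that pairwise_orthogonal_independent by (auto simp: P_def)
    then show ?thesis using independent_bound[of B] by simp
  qed
  have "P {}" by (simp add: P_def)
  then have "\<exists>B. P B \<and> (\<forall>C. P C \<longrightarrow> card C \<le> card B)"
    by (rule ex_has_greatest_nat[where b = "Suc CARD('n)"]) (use bound in \<open>simp add: le_SucI less_Suc_eq_le\<close>)
  then obtain B where B: "P B" and maxB: "\<And>C. P C \<Longrightarrow> card C \<le> card B"
    by blast
  have "span B = UNIV"
  proof (rule ccontr)
    assume "span B \<noteq> UNIV"
    then obtain a where a: "a \<noteq> 0" "\<forall>x\<in>span B. a \<bullet> x = 0"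
      using span_not_UNIV_orthogonal by blast
    define S where "S = {x. \<forall>v\<in>B. x \<bullet> v = 0}"
    have "subspace S" by (auto simp: S_def subspace_def inner_add_left)
    moreover have "S \<noteq> {0}" using a by (auto simp: S_def span_base)
    moreover have "A *v x \<in> S" if "x \<in> S" for x
      unfolding S_def
    proof safe
      fix v assume "v \<in> B"
      moreover obtain c where "A *v v = c *\<^sub>R v" using B \<open>v \<in> B\<close> by (auto simp: P_def)
      ultimately show "(A *v x) \<bullet> v = 0"
        using symmetric_inner_commute[OF sym, of x v] that by (simp add: S_def)
    qed
    ultimately obtain v c where v: "v \<in> S" "norm v = 1" "A *v v = c *\<^sub>R v"
      by (rule symmetric_invariant_subspace_eigenvector[OF sym])
    have "v \<notin> B" using v by (force simp: S_def)
    have "P (insert v B)"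
      using B v by (auto simp: P_def S_def pairwise_insert orthogonal_def inner_commute)
    then have "card (insert v B) \<le> card B" by (rule maxB)
    then show False using bound[OF B] \<open>v \<notin> B\<close> by simp
  qed
  moreover obtain ev where "\<And>v. v \<in> B \<Longrightarrow> A *v v = ev v *\<^sub>R v"
    using bchoice[of B "\<lambda>v c. A *v v = c *\<^sub>R v"] B unfolding P_def by blast
  ultimately have "orthonormal_eigenbasis A B ev"
    using B by unfold_locales (auto simp: P_def)
  then show ?thesis by (rule that)
qed

context orthonormal_eigenbasis
begin

lemma finite_basis: "finite B"
proof -
  have "0 \<notin> B" using unit by force
  then show ?thesis using orth pairwise_orthogonal_independent independent_imp_finite by blast
qed

lemma expansion: "(\<Sum>v\<in>B. (x \<bullet> v) *\<^sub>R v) = x"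
  using orthonormal_basis_expand[OF orth unit _ finite_basis] span by auto

lemma inner_expansion: "x \<bullet> y = (\<Sum>v\<in>B. (x \<bullet> v) * (y \<bullet> v))"
  by (subst expansion[of y, symmetric]) (simp add: inner_sum_right mult.commute)

lemma inner_basis: "v \<in> B \<Longrightarrow> w \<in> B \<Longrightarrow> v \<bullet> w = (if v = w then 1 else 0)"
  using orth unit by (auto simp: pairwise_def orthogonal_def simp flip: power2_norm_eq_inner)

lemma vector_eqI: "(\<And>v. v \<in> B \<Longrightarrow> x \<bullet> v = y \<bullet> v) \<Longrightarrow> x = y"
  by (metis (mono_tags, lifting) expansion sum.cong)

lemma matrix_eqI:
  assumes "\<And>v. v \<in> B \<Longrightarrow> C *v v = D *v v"
  shows "C = D"
proof -
  have "C *v x = D *v x" for x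
  proof -
    have "x \<in> span B" by (simp add: span)
    then show ?thesis
      using linear_eq_on_span[of "(*v) C" "(*v) D" B x] assms by simp
  qed
  then show ?thesis by (simp add: matrix_eq)
qed

text \<open>Both matrices have the same entries with respect to \<open>B\<close>, where
  \<open>A\<close> is diagonal. A matrix built from its eigenbasis is thereby known to be
  symmetric.\<close>

lemma transpose_eq: "transpose A = A"
proof (rule matrix_eqI)
  fix v assume v: "v \<in> B"
  have "(transpose A *v v) \<bullet> w = (A *v v) \<bullet> w" if "w \<in> B" for w
    using v that eigen inner_basis[OF v that]
    by (auto simp: dot_lmul_matrix split: if_splits)
  then show "transpose A *v v = A *v v" by (rule vector_eqI)
qed

lemma inner_mult: "v \<in> B \<Longrightarrow> (A *v x) \<bullet> v = ev v * (x \<bullet> v)"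
  using symmetric_inner_commute[OF transpose_eq, of x v] eigen by simp

lemma quadratic_form_expansion: "x \<bullet> (A *v x) = (\<Sum>v\<in>B. ev v * (x \<bullet> v)\<^sup>2)"
  by (simp add: inner_expansion[of x "A *v x"] inner_mult power2_eq_square algebra_simps)

lemma ev_eigenvalue: "v \<in> B \<Longrightarrow> ev v \<in> eigenvalues A"
  using eigen[of v] unit[of v] by (auto simp: eigenvalues_def intro!: exI[of _ v])

lemma basis_nonempty: "B \<noteq> {}"
proof
  assume "B = {}"
  then have "(axis undefined 1 :: real ^ 'n) = 0" using vector_eqI by blast
  then show False by (simp add: axis_eq_0_iff)
qed

end

section \<open>Positive definite square roots\<close>

locale positive_eigenbasis = orthonormal_eigenbasis A B ev
  for A :: "real ^ 'n ^ 'n" and B ev +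
  assumes ev_pos: "v \<in> B \<Longrightarrow> ev v > 0"
begin

lemma sym_pos_def: "sym_pos_def A"
  unfolding sym_pos_def_def
proof (intro conjI allI impI transpose_eq)
  fix x :: "real ^ 'n" assume "x \<noteq> 0"
  then obtain v where "v \<in> B" "x \<bullet> v \<noteq> 0" using vector_eqI[of x 0] by auto
  then show "x \<bullet> (A *v x) > 0"
    unfolding quadratic_form_expansion using ev_pos finite_basis by (auto intro!: sum_pos2[of _ v] simp: less_imp_le)
qed

lemma square_root_eigenvector:
  assumes C: "sym_pos_def C" "C ** C = A" and v: "v \<in> B"
  shows "C *v v = sqrt (ev v) *\<^sub>R v"
proof -
  txt \<open>The residual \<open>w\<close> satisfies \<open>C w = - sqrt (ev v) w\<close> because \<open>C\<^sup>2 v = ev v v\<close>.\<close>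
  define w where "w = C *v v - sqrt (ev v) *\<^sub>R v"
  have "C *v (C *v v) = ev v *\<^sub>R v"
    using C eigen[OF v] by (simp add: matrix_vector_mul_assoc)
  then have "C *v w = - sqrt (ev v) *\<^sub>R w"
    using ev_pos[OF v]
    by (simp add: w_def matrix_vector_mult_diff_distrib matrix_vector_mult_scaleR algebra_simps)
  then have "w \<bullet> (C *v w) \<le> 0" using ev_pos[OF v] by simp
  then have "w = 0" using C by (force simp: sym_pos_def_def)
  then show ?thesis by (simp add: w_def)
qed

text \<open>The matrix \<open>C\<close> with eigenvalues \<open>sqrt (ev v)\<close> on
  \<open>B\<close> is a positive definite root, and \<open>square_root_eigenvector\<close> forces
  every other one to agree with it on \<open>B\<close>. Hence the definite description in
  \<open>matrix_sqrt\<close> denotes \<open>C\<close>.\<close>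

lemma matrix_sqrt_eigenbasis: "orthonormal_eigenbasis (matrix_sqrt A) B (\<lambda>v. sqrt (ev v))"
proof -
  define C where "C = matrix (\<lambda>x. \<Sum>v\<in>B. (sqrt (ev v) * (x \<bullet> v)) *\<^sub>R v)"
  have "linear (\<lambda>x. \<Sum>v\<in>B. (sqrt (ev v) * (x \<bullet> v)) *\<^sub>R v)"
    by (rule linearI) (simp_all add: inner_add_left algebra_simps sum.distrib scaleR_sum_right)
  then have C: "C *v x = (\<Sum>v\<in>B. (sqrt (ev v) * (x \<bullet> v)) *\<^sub>R v)" for x
    by (simp add: C_def matrix_works)
  have Cv: "C *v v = sqrt (ev v) *\<^sub>R v" if "v \<in> B" for v
  proof -
    have "C *v v = (\<Sum>w\<in>B. if v = w then sqrt (ev w) *\<^sub>R w else 0)"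
      unfolding C using that by (intro sum.cong) (auto simp: inner_basis)
    then show ?thesis using that finite_basis by simp
  qed
  interpret C: positive_eigenbasis C B "\<lambda>v. sqrt (ev v)"
    using Cv ev_pos orth unit span by unfold_locales auto
  have "C ** C = A"
  proof (rule matrix_eqI)
    fix v assume "v \<in> B"
    then show "(C ** C) *v v = A *v v"
      using Cv eigen ev_pos[of v]
      by (simp add: matrix_vector_mult_scaleR flip: matrix_vector_mul_assoc)
  qed
  then have "matrix_sqrt A = C"
    unfolding matrix_sqrt_def using C.sym_pos_def square_root_eigenvector Cv
    by (intro the_equality) (auto intro!: matrix_eqI)
  then show ?thesis using C.orthonormal_eigenbasis_axioms by simp
qed

lemma inner_matrix_power: "v \<in> B \<Longrightarrow> (matrix_power A k *v x) \<bullet> v = ev v ^ k * (x \<bullet> v)"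
  by (induction k) (simp_all add: inner_mult flip: matrix_vector_mul_assoc)

lemma inner_half_integer_power:
  assumes v: "v \<in> B"
  shows "(half_integer_power A (real m / 2) *v x) \<bullet> v = sqrt (ev v) ^ m * (x \<bullet> v)"
proof -
  interpret S: orthonormal_eigenbasis "matrix_sqrt A" B "\<lambda>v. sqrt (ev v)"
    by (rule matrix_sqrt_eigenbasis)
  have even_power: "ev v ^ k = sqrt (ev v) ^ (2 * k)" for k
    using ev_pos[OF v] by (simp add: power_mult)
  show ?thesis
  proof (cases "even m")
    case True
    then show ?thesis
      using inner_matrix_power[OF v, of "m div 2" x] v
      by (simp add: half_integer_power_def even_power)
  next
    case False
    then have "m = Suc (2 * (m div 2))" by presburger
    then have "sqrt (ev v) ^ m = sqrt (ev v) ^ (2 * (m div 2)) * sqrt (ev v)"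
      by (metis power_Suc2)
    then show ?thesis
      using False inner_matrix_power[OF v, of "m div 2" "matrix_sqrt A *v x"] v
      by (simp add: half_integer_power_def S.inner_mult even_power flip: matrix_vector_mul_assoc)
  qed
qed

section \<open>Spectral moments\<close>

lemma (in -) sqrt_power_square: "x \<ge> 0 \<Longrightarrow> (sqrt x ^ m)\<^sup>2 = x ^ m"
  by (metis mult.commute power_mult real_sqrt_pow2)

definition moment :: "real ^ 'n \<Rightarrow> nat \<Rightarrow> real" where
  "moment e j = (\<Sum>v\<in>B. ev v ^ j * (e \<bullet> v)\<^sup>2)"

lemma moment_zero [simp]: "moment 0 j = 0"
  by (simp add: moment_def)

lemma moment_nonneg: "moment e j \<ge> 0"
  unfolding moment_def by (intro sum_nonneg mult_nonneg_nonneg) (auto simp: ev_pos less_imp_le)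

lemma moment_pos:
  assumes "e \<noteq> 0"
  shows "moment e j > 0"
proof -
  obtain v where "v \<in> B" "e \<bullet> v \<noteq> 0" using vector_eqI[of e 0] assms by auto
  then show ?thesis unfolding moment_def
    using ev_pos finite_basis by (auto intro!: sum_pos2[of _ v] simp: less_imp_le)
qed

lemma moment_step:
  "moment (e - t *\<^sub>R (A *v e)) j = moment e j - 2 * t * moment e (j + 1) + t\<^sup>2 * moment e (j + 2)"
  unfolding moment_def sum_distrib_left sum_subtractf[symmetric] sum.distrib[symmetric]
  by (intro sum.cong)
    (simp_all add: inner_diff_left inner_mult power2_eq_square algebra_simps)

lemma moment_log_convex: "(moment e (j + 1))\<^sup>2 \<le> moment e j * moment e (j + 2)"
proof -
  let ?a = "\<lambda>i v. sqrt (ev v) ^ i * (e \<bullet> v)"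
  have sq: "(\<Sum>v\<in>B. (?a i v)\<^sup>2) = moment e i" for i
    unfolding moment_def
    by (intro sum.cong) (auto simp: power_mult_distrib sqrt_power_square ev_pos less_imp_le)
  have "(\<Sum>v\<in>B. ?a j v * ?a (j + 2) v) = (\<Sum>v\<in>B. (?a (j + 1) v)\<^sup>2)"
    by (intro sum.cong) (auto simp: power2_eq_square)
  then show ?thesis
    using Cauchy_Schwarz_ineq_sum[of "?a j" "?a (j + 2)" B] unfolding sq by simp
qed

lemma moment_ratio_mono:
  assumes "i \<le> j"
  shows "moment e (i + 1) * moment e j \<le> moment e i * moment e (j + 1)"
proof (cases "e = 0")
  case False
  note pos = moment_pos[OF False]
  have "moment e (i + 1) / moment e i \<le> moment e (j + 1) / moment e j"
    using assms
  proof (rule lift_Suc_mono_le[rotated])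
    show "moment e (k + 1) / moment e k \<le> moment e (Suc k + 1) / moment e (Suc k)" for k
      using moment_log_convex[of e k] pos by (simp add: field_simps power2_eq_square)
  qed
  then show ?thesis using pos[of i] pos[of j] by (simp add: field_simps)
qed simp

lemma moment_bounds:
  assumes bounds: "\<forall>v\<in>B. a \<le> ev v \<and> ev v \<le> c" and "a \<ge> 0"
  shows "a ^ k * moment e j \<le> moment e (j + k)" "moment e (j + k) \<le> c ^ k * moment e j"
proof -
  have "a ^ k * (ev v ^ j * (e \<bullet> v)\<^sup>2) \<le> ev v ^ (j + k) * (e \<bullet> v)\<^sup>2"
    "ev v ^ (j + k) * (e \<bullet> v)\<^sup>2 \<le> c ^ k * (ev v ^ j * (e \<bullet> v)\<^sup>2)" if "v \<in> B" for v
    using bounds that \<open>a \<ge> 0\<close> ev_pos[OF that]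
      mult_right_mono[of "a ^ k" "ev v ^ k" "ev v ^ j * (e \<bullet> v)\<^sup>2"]
      mult_right_mono[of "ev v ^ k" "c ^ k" "ev v ^ j * (e \<bullet> v)\<^sup>2"]
    by (simp_all add: power_mono power_add mult_ac)
  then show "a ^ k * moment e j \<le> moment e (j + k)" "moment e (j + k) \<le> c ^ k * moment e j"
    by (auto simp: moment_def sum_distrib_left intro!: sum_mono)
qed

lemma moment_kantorovich:
  assumes bounds: "\<forall>v\<in>B. a \<le> ev v \<and> ev v \<le> c" and ac: "a > 0" "c > 0"
  shows "4 * c * a * moment e j * moment e (j + 2) \<le> (c + a)\<^sup>2 * (moment e (j + 1))\<^sup>2"
proof -
  txt \<open>Sum \<open>(ev v - a) (c - ev v) \<ge> 0\<close> over the basis, then apply AM-GM.\<close>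
  have "moment e (j + 2) + c * a * moment e j \<le> (c + a) * moment e (j + 1)"
    unfolding moment_def sum_distrib_left sum.distrib[symmetric]
  proof (rule sum_mono)
    fix v assume v: "v \<in> B"
    have "0 \<le> (ev v - a) * (c - ev v) * (ev v ^ j * (e \<bullet> v)\<^sup>2)"
      using bounds v ev_pos[OF v] by simp
    then show "ev v ^ (j + 2) * (e \<bullet> v)\<^sup>2 + c * a * (ev v ^ j * (e \<bullet> v)\<^sup>2)
        \<le> (c + a) * (ev v ^ (j + 1) * (e \<bullet> v)\<^sup>2)"
      by (simp add: algebra_simps power2_eq_square)
  qed
  then have "(moment e (j + 2) + c * a * moment e j)\<^sup>2 \<le> ((c + a) * moment e (j + 1))\<^sup>2"
    using ac moment_nonneg by (intro power_mono add_nonneg_nonneg mult_nonneg_nonneg) auto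
  moreover have "4 * c * a * moment e j * moment e (j + 2)
      \<le> (moment e (j + 2) + c * a * moment e j)\<^sup>2"
    using zero_le_power2[of "moment e (j + 2) - c * a * moment e j"]
    by (simp add: power2_eq_square algebra_simps)
  ultimately show ?thesis by (simp add: power_mult_distrib)
qed

section \<open>One step of the method\<close>

lemma quad_grad_eq: "quad_grad A b x = A *v (x - quad_minimizer A b)"
  using quad_minimizer_solves[OF sym_pos_def, of b]
  by (simp add: quad_grad_def matrix_vector_mult_diff_distrib)

lemma quad_obj_gap:
  "quad_obj A b x - quad_obj A b (quad_minimizer A b) = moment (x - quad_minimizer A b) 1 / 2"
proof -
  define z where "z = quad_minimizer A b"
  have z: "A *v z = b" using quad_minimizer_solves[OF sym_pos_def] by (simp add: z_def)
  have "moment (x - z) 1 = (x - z) \<bullet> (A *v (x - z))"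
    by (simp add: moment_def quadratic_form_expansion)
  also have "\<dots> = 2 * (quad_obj A b x - quad_obj A b z)"
    using symmetric_inner_commute[OF transpose_eq, of z x]
    by (simp add: quad_obj_def matrix_vector_mult_diff_distrib inner_diff_left inner_diff_right
        z inner_commute)
  finally show ?thesis by (simp add: z_def)
qed

text \<open>For \<open>e = 0\<close> the quotient is \<open>0 / 0 = 0\<close>, in agreement with the convention for a zero gradient.\<close>

lemma mgd_stepsize_eq:
  assumes "e = x - quad_minimizer A b"
  shows "mgd_stepsize A b (real m / 2) x = moment e (m + 2) / moment e (m + 3)"
proof (cases "e = 0")
  case True
  then show ?thesis using assms quad_grad_eq[of b x] by (simp add: mgd_stepsize_def)
next
  case False
  define y where "y = half_integer_power A (real m / 2) *v (A *v e)"
  have "A *v e \<noteq> 0" using False sym_pos_def by (force simp: sym_pos_def_def)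
  moreover have y: "(y \<bullet> v)\<^sup>2 = ev v ^ (m + 2) * (e \<bullet> v)\<^sup>2" if "v \<in> B" for v
  proof -
    have "(sqrt (ev v) ^ m)\<^sup>2 = ev v ^ m"
      using ev_pos[OF that] by (simp add: sqrt_power_square)
    then show ?thesis
      using that by (simp add: y_def inner_half_integer_power inner_mult power_mult_distrib
          power_add algebra_simps) (simp add: power2_eq_square)
  qed
  have "y \<bullet> y = moment e (m + 2)"
    unfolding inner_expansion[of y y] moment_def
    by (intro sum.cong) (auto simp: y simp flip: power2_eq_square)
  moreover have "y \<bullet> (A *v y) = moment e (m + 3)"
    unfolding inner_expansion[of y "A *v y"] moment_def
  proof (intro sum.cong refl)
    fix v assume v: "v \<in> B"
    have "(y \<bullet> v) * ((A *v y) \<bullet> v) = ev v * (y \<bullet> v)\<^sup>2"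
      using v by (simp add: inner_mult power2_eq_square)
    then show "(y \<bullet> v) * ((A *v y) \<bullet> v) = ev v ^ (m + 3) * (e \<bullet> v)\<^sup>2"
      using y[OF v] by (simp add: numeral_3_eq_3)
  qed
  ultimately show ?thesis
    using assms by (simp add: mgd_stepsize_def quad_grad_eq[of b x] y_def)
qed

lemma moment_contraction:
  assumes bounds: "\<forall>v\<in>B. a \<le> ev v \<and> ev v \<le> c" and ac: "0 < a" "a \<le> c"
    and \<omega>: "0 < \<omega>" "\<omega> < 2"
    and t: "t = \<omega> * (moment e (m + 2) / moment e (m + 3))"
  shows "moment (e - t *\<^sub>R (A *v e)) 1 \<le> (1 - \<omega> * (2 - \<omega>) * (a / c)) * moment e 1" (is ?I)
    and "moment (e - t *\<^sub>R (A *v e)) (m + 1)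
      \<le> (1 - \<omega> * (2 - \<omega>) * (4 * c * a / (c + a)\<^sup>2)) * moment e (m + 1)" (is ?II)
proof -
  define M where "M = moment e"
  define \<alpha> where "\<alpha> = M (m + 2) / M (m + 3)"
  have t: "t = \<omega> * \<alpha>" using t by (simp add: \<alpha>_def M_def)
  have \<omega>': "\<omega> * (2 - \<omega>) \<ge> 0" using \<omega> by simp
  have "?I \<and> ?II"
  proof (cases "e = 0")
    case False
    have pos: "M j > 0" for j using moment_pos[OF False] by (simp add: M_def)
    have "\<alpha> > 0" using pos by (simp add: \<alpha>_def)
    have "\<alpha> * M 3 \<le> M 2"
      using moment_ratio_mono[of 2 "m + 2" e] pos[of "m + 3"]
      by (simp add: \<alpha>_def field_simps eval_nat_numeral flip: M_def)
    then have "\<alpha> * (\<alpha> * M 3) \<le> \<alpha> * M 2"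
      using \<open>\<alpha> > 0\<close> by (intro mult_left_mono) simp_all
    then have "\<omega>\<^sup>2 * (\<alpha> * (\<alpha> * M 3)) \<le> \<omega>\<^sup>2 * (\<alpha> * M 2)"
      by (rule mult_left_mono) simp
    moreover have "moment (e - t *\<^sub>R (A *v e)) 1 = M 1 - 2 * t * M 2 + t\<^sup>2 * M 3"
      using moment_step[of e t 1] by (simp add: M_def eval_nat_numeral)
    ultimately have "moment (e - t *\<^sub>R (A *v e)) 1 \<le> M 1 - \<omega> * (2 - \<omega>) * (\<alpha> * M 2)"
      unfolding t by (simp add: power2_eq_square algebra_simps)
    moreover have "(a / c) * M 1 \<le> \<alpha> * M 2"
    proof -
      have "M (m + 3) \<le> c * M (m + 2)" "a * M 1 \<le> M 2"
        using moment_bounds(2)[OF bounds, where k = 1 and e = e and j = "m + 2"]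
          moment_bounds(1)[OF bounds, where k = 1 and e = e and j = 1] ac
        by (simp_all add: M_def numeral_3_eq_3 numeral_2_eq_2)
      then have "1 / c \<le> \<alpha>" using pos[of "m + 3"] ac by (simp add: \<alpha>_def field_simps)
      then have "1 / c * (a * M 1) \<le> \<alpha> * M 2"
        using \<open>a * M 1 \<le> M 2\<close> \<open>\<alpha> > 0\<close> pos[of 1] ac by (intro mult_mono) auto
      then show ?thesis by simp
    qed
    from mult_left_mono[OF this \<omega>']
    have "\<omega> * (2 - \<omega>) * (a / c) * M 1 \<le> \<omega> * (2 - \<omega>) * (\<alpha> * M 2)" by (simp only: mult.assoc)
    ultimately have ?I by (simp add: M_def left_diff_distrib)
    have "moment (e - t *\<^sub>R (A *v e)) (m + 1) = M (m + 1) - 2 * t * M (m + 2) + t\<^sup>2 * M (m + 3)"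
      using moment_step[of e t "m + 1"] by (simp add: M_def eval_nat_numeral)
    also have "\<dots> = M (m + 1) - 2 * \<omega> * (\<alpha> * M (m + 2)) + \<omega>\<^sup>2 * (\<alpha> * (\<alpha> * M (m + 3)))"
      by (simp add: t power2_eq_square)
    also have "\<alpha> * M (m + 3) = M (m + 2)" using pos[of "m + 3"] by (simp add: \<alpha>_def)
    finally have "moment (e - t *\<^sub>R (A *v e)) (m + 1)
        = M (m + 1) - \<omega> * (2 - \<omega>) * (\<alpha> * M (m + 2))"
      by (simp only: power2_eq_square left_diff_distrib right_diff_distrib mult.assoc)
    moreover have "(4 * c * a / (c + a)\<^sup>2) * M (m + 1) \<le> \<alpha> * M (m + 2)"
    proof -
      have "4 * c * a * M (m + 1) * M (m + 3) \<le> (c + a)\<^sup>2 * (M (m + 2))\<^sup>2"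
        using moment_kantorovich[OF bounds, where e = e and j = "m + 1"] ac
        by (simp add: M_def numeral_3_eq_3)
      moreover have "(c + a)\<^sup>2 > 0" using ac by simp
      ultimately show ?thesis using pos[of "m + 3"]
        by (simp add: \<alpha>_def field_simps power2_eq_square[of "M _"])
    qed
    from mult_left_mono[OF this \<omega>']
    have "\<omega> * (2 - \<omega>) * (4 * c * a / (c + a)\<^sup>2) * M (m + 1) \<le> \<omega> * (2 - \<omega>) * (\<alpha> * M (m + 2))"
      by (simp only: mult.assoc)
    ultimately have ?II by (simp add: M_def left_diff_distrib)
    with \<open>?I\<close> show ?thesis ..
  qed simp
  then show ?I ?II by auto
qed

end

lemma geometric_bound:
  fixes u :: "nat \<Rightarrow> real"
  assumes "\<And>k. u (Suc k) \<le> r * u k" "r \<ge> 0"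
  shows "u k \<le> r ^ k * u 0"
proof (induction k)
  case (Suc k)
  have "u (Suc k) \<le> r * u k" by (rule assms)
  also have "\<dots> \<le> r * (r ^ k * u 0)" using Suc assms by (intro mult_left_mono)
  finally show ?case by (simp add: mult.assoc)
qed simp

theorem theorem10:
  fixes A :: "real ^ 'n ^ 'n" and b x0 :: "real ^ 'n"
    and l \<omega> \<kappa> f_star :: real and f :: "real ^ 'n \<Rightarrow> real" and x :: "nat \<Rightarrow> real ^ 'n"
  assumes "sym_pos_def A"
    and "l \<in> {real m / 2 | m :: nat. True}"
    and "\<omega> \<in> {0<..<2}"
    and "\<kappa> = condition_number A"
    and "f = quad_obj A b"
    and "f_star = f (quad_minimizer A b)"
    and "x = relaxed_mgd A b l \<omega> x0"
  shows "\<forall>k. f (x k) - f_star \<le> (1 - \<omega> * (2 - \<omega>) * (1 / \<kappa>)) ^ k * (f x0 - f_star)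
           \<and> f (x k) - f_star \<le> \<kappa> powr (2 * l) * rate_factor A \<omega> ^ k * (f x0 - f_star)"
proof -
  have sym: "transpose A = A" using assms(1) by (simp add: sym_pos_def_def)
  obtain m where l: "l = real m / 2" using assms(2) by blast
  have \<omega>: "0 < \<omega>" "\<omega> < 2" using assms(3) by auto
  obtain B ev where "orthonormal_eigenbasis A B ev"
    using symmetric_orthonormal_eigenbasis[OF sym] .
  then interpret E: orthonormal_eigenbasis A B ev .
  have eigenvalue_pos: "c > 0" if "c \<in> eigenvalues A" for c
  proof -
    from that obtain v where v: "v \<noteq> 0" "A *v v = c *\<^sub>R v" by (auto simp: eigenvalues_def)
    then have "0 < c * (v \<bullet> v)" using assms(1) by (metis sym_pos_def_def inner_scaleR_right)
    moreover have "v \<bullet> v > 0" using v by simp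
    ultimately show ?thesis by (simp only: zero_less_mult_pos2)
  qed
  interpret E: positive_eigenbasis A B ev
    using eigenvalue_pos E.ev_eigenvalue by unfold_locales blast
  define a c where "a = min_eigenvalue A" and "c = max_eigenvalue A"
  have bounds: "\<forall>v\<in>B. a \<le> ev v \<and> ev v \<le> c"
    using E.ev_eigenvalue finite_eigenvalues[OF sym]
    by (simp_all add: a_def c_def min_eigenvalue_def max_eigenvalue_def)
  have a: "a > 0"
    using eigenvalue_pos Min_in[OF finite_eigenvalues[OF sym] eigenvalues_nonempty[OF sym]]
    by (simp add: a_def min_eigenvalue_def)
  have ac: "a \<le> c" using bounds E.basis_nonempty by (meson all_not_in_conv order_trans)
  have \<kappa>: "\<kappa> = c / a" using assms(4) by (simp add: condition_number_def a_def c_def)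
  define e where "e = (\<lambda>k. x k - quad_minimizer A b)"
  define r where "r = 1 - \<omega> * (2 - \<omega>) * (1 / \<kappa>)"
  define s where "s = rate_factor A \<omega>"
  have step: "e (Suc k) = e k - (\<omega> * (E.moment (e k) (m + 2) / E.moment (e k) (m + 3))) *\<^sub>R (A *v e k)"
    for k
    using E.mgd_stepsize_eq[of "e k" "x k" b m] E.quad_grad_eq[of b "x k"]
    by (simp add: e_def assms(7) l Let_def)
  have s: "s = 1 - \<omega> * (2 - \<omega>) * (4 * c * a / (c + a)\<^sup>2)"
    by (simp add: s_def rate_factor_def a_def c_def)
  have stepI: "E.moment (e (Suc k)) 1 \<le> r * E.moment (e k) 1"
    and stepII: "E.moment (e (Suc k)) (m + 1) \<le> s * E.moment (e k) (m + 1)" for k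
    using E.moment_contraction[OF bounds a ac \<omega> refl, where e = "e k" and m = m] unfolding step s
    by (simp_all add: r_def \<kappa>)
  have \<omega>1: "\<omega> * (2 - \<omega>) \<le> 1"
    using zero_le_power2[of "\<omega> - 1"] by (simp add: power2_eq_square algebra_simps)
  have r0: "r \<ge> 0" and s0: "s \<ge> 0"
  proof -
    have q: "1 - \<omega> * (2 - \<omega>) * q \<ge> 0" if "0 \<le> q" "q \<le> 1" for q
      using mult_mono[OF \<omega>1 that(2)] that \<omega> by simp
    show "r \<ge> 0" unfolding r_def using a ac by (intro q) (auto simp: \<kappa>)
    have "4 * c * a \<le> (c + a)\<^sup>2"
      using zero_le_power2[of "c - a"] by (simp add: power2_eq_square algebra_simps)
    moreover have "(c + a)\<^sup>2 > 0" using a ac by simp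
    ultimately show "s \<ge> 0" unfolding s using a ac by (intro q) auto
  qed
  have gap: "f y - f_star = E.moment (y - quad_minimizer A b) 1 / 2" for y
    using E.quad_obj_gap assms(5,6) by simp
  have e0: "e 0 = x0 - quad_minimizer A b" by (simp add: e_def assms(7))
  show ?thesis
  proof (intro allI conjI)
    fix k
    have "E.moment (e k) 1 \<le> r ^ k * E.moment (e 0) 1"
      using geometric_bound[of "\<lambda>k. E.moment (e k) 1"] stepI r0 by blast
    then show "f (x k) - f_star \<le> (1 - \<omega> * (2 - \<omega>) * (1 / \<kappa>)) ^ k * (f x0 - f_star)"
      unfolding gap by (simp add: r_def e0) (simp add: e_def)
    have "a ^ m * E.moment (e k) 1 \<le> E.moment (e k) (m + 1)"
      using E.moment_bounds(1)[OF bounds, where k = m and e = "e k" and j = 1] a by (simp add: add.commute)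
    also have "\<dots> \<le> s ^ k * E.moment (e 0) (m + 1)"
      using geometric_bound[of "\<lambda>k. E.moment (e k) (m + 1)"] stepII s0 by blast
    also have "\<dots> \<le> s ^ k * (c ^ m * E.moment (e 0) 1)"
      using E.moment_bounds(2)[OF bounds, where k = m and e = "e 0" and j = 1] a s0
      by (intro mult_left_mono) (auto simp: add.commute)
    finally have "E.moment (e k) 1 \<le> (c / a) ^ m * s ^ k * E.moment (e 0) 1"
      using a by (simp add: field_simps)
    moreover have "\<kappa> powr (2 * l) = (c / a) ^ m"
      using a ac by (simp add: \<kappa> l powr_realpow)
    ultimately show "f (x k) - f_star \<le> \<kappa> powr (2 * l) * rate_factor A \<omega> ^ k * (f x0 - f_star)"
      unfolding gap by (simp add: s_def e0) (simp add: e_def)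
  qed
qed

end
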